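(* Let $\mathbb{K}$ be an algebraically closed field of characteristic zero, let $m$ and $k$ be positive integers, let $\mathfrak{s}\in\mathcal{S}_{m,k}$, and for a positive integer $l$ let $\mathfrak{a}_l$ denote the $l$-dimensional abelian Lie algebra over $\mathbb{K}$. Then the direct sum of Lie algebras $\mathfrak{s}\oplus\mathfrak{a}_l$ is non-rigid in $\mathcal{S}_{m+l,k}$ for all $l\in\mathbb{N}$.
   Context: For a Lie bracket $\mu$ put $\mu^{(1)}=\mu$ and, for $k\ge 2$, $\mu^{(k)}=\mu(\mu^{(k-1)},\mu^{(k-1)})$, a $2^k$-multilinear map (the first $2^{k-1}$ arguments go in the first copy of $\mu^{(k-1)}$, the others in the second). $\mathcal{S}_{n,k}$ is the affine algebraic variety (with Zariski topology) of all Lie brackets $\mu:\mathbb{K}^n\times\mathbb{K}^n\to\mathbb{K}^n$ with $\mu^{(k)}=0$, i.e. solvable of solvability index at most $k$. $\operatorname{GL}_n(\mathbb{K})$ acts by change of basis, $(g\cdot\mu)(x,y)=g\mu(g^{-1}x,g^{-1}y)$. A Lie bracket $\mu\in\mathcal{S}_{n,k}$ is rigid in $\mathcal{S}_{n,k}$ if its orbit is Zariski open in $\mathcal{S}_{n,k}$; otherwise it is non-rigid. A Lie algebra of dimension $n$ is identified with its bracket via any choice of basis.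
   Formalization: The formal theorem assumes k ≥ 2 instead of k ≥ 1: for k = 1 the variety consists only of the zero bracket, whose orbit is the whole variety and hence open, so the direct sum is rigid and the claim fails. *)

theory Defs
  imports "HOL-Analysis.Analysis" "HOL-Computational_Algebra.Polynomial"
begin

inductive_set polynomial_functions :: "(('v \<Rightarrow> 'a::comm_ring_1) \<Rightarrow> 'a) set" where
  const: "(\<lambda>_. c) \<in> polynomial_functions"
| coordinate: "(\<lambda>x. x i) \<in> polynomial_functions"
| add: "p \<in> polynomial_functions \<Longrightarrow> q \<in> polynomial_functions \<Longrightarrow>
    (\<lambda>x. p x + q x) \<in> polynomial_functions"
| mult: "p \<in> polynomial_functions \<Longrightarrow> q \<in> polynomial_functions \<Longrightarrow>
    (\<lambda>x. p x * q x) \<in> polynomial_functions"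

definition zero_locus :: "(('v \<Rightarrow> 'a::comm_ring_1) \<Rightarrow> 'a) set \<Rightarrow> ('v \<Rightarrow> 'a) set" where
  "zero_locus F = {x. \<forall>p\<in>F. p x = 0}"

definition zariski :: "('v \<Rightarrow> 'a::idom) topology" where
  "zariski = topology (\<lambda>U. \<exists>F \<subseteq> polynomial_functions. - U = zero_locus F)"

lemma openin_zariski:
  "openin (zariski :: ('v \<Rightarrow> 'a::idom) topology) U \<longleftrightarrow>
    (\<exists>F \<subseteq> polynomial_functions. - U = zero_locus F)"
proof -
  have "istopology (\<lambda>U :: ('v \<Rightarrow> 'a) set. \<exists>F \<subseteq> polynomial_functions. - U = zero_locus F)"
    unfolding istopology_def
  proof (intro conjI allI impI)
    fix S T :: "('v \<Rightarrow> 'a) set"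
    assume "\<exists>F \<subseteq> polynomial_functions. - S = zero_locus F"
      and "\<exists>F \<subseteq> polynomial_functions. - T = zero_locus F"
    then obtain F G where FG: "F \<subseteq> polynomial_functions" "- S = zero_locus F"
        "G \<subseteq> polynomial_functions" "- T = zero_locus G"
      by blast
    let ?H = "{\<lambda>x. p x * q x | p q. p \<in> F \<and> q \<in> G}"
    have "?H \<subseteq> polynomial_functions"
      using FG by (auto intro!: polynomial_functions.mult)
    moreover have "zero_locus ?H = zero_locus F \<union> zero_locus G"
    proof
      show "zero_locus ?H \<subseteq> zero_locus F \<union> zero_locus G"
      proof
        fix x assume x: "x \<in> zero_locus ?H"
        have "p x * q x = 0" if "p \<in> F" "q \<in> G" for p q
          using x that unfolding zero_locus_def by fastforce
        then show "x \<in> zero_locus F \<union> zero_locus G"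
          unfolding zero_locus_def by auto
      qed
    qed (auto simp: zero_locus_def)
    then have "- (S \<inter> T) = zero_locus ?H"
      using FG by (simp add: Compl_Int)
    ultimately show "\<exists>F \<subseteq> polynomial_functions. - (S \<inter> T) = zero_locus F"
      by blast
  next
    fix \<K> :: "('v \<Rightarrow> 'a) set set"
    assume "\<forall>K\<in>\<K>. \<exists>F \<subseteq> polynomial_functions. - K = zero_locus F"
    then obtain F where F: "\<And>K. K \<in> \<K> \<Longrightarrow> F K \<subseteq> polynomial_functions \<and> - K = zero_locus (F K)"
      by metis
    have "(\<Union>K\<in>\<K>. F K) \<subseteq> polynomial_functions"
      using F by blast
    moreover have "- \<Union>\<K> = zero_locus (\<Union>K\<in>\<K>. F K)"
    proof -
      have "- \<Union>\<K> = (\<Inter>K\<in>\<K>. - K)" by auto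
      also have "\<dots> = (\<Inter>K\<in>\<K>. zero_locus (F K))" using F by auto
      also have "\<dots> = zero_locus (\<Union>K\<in>\<K>. F K)" by (auto simp: zero_locus_def)
      finally show ?thesis .
    qed
    ultimately show "\<exists>F \<subseteq> polynomial_functions. - \<Union>\<K> = zero_locus F"
      by blast
  qed
  then show ?thesis
    unfolding zariski_def by simp
qed

type_synonym ('a, 'n) bracket = "'a ^ 'n \<Rightarrow> 'a ^ 'n \<Rightarrow> 'a ^ 'n"

definition lie_bracket :: "('a::field, 'n::finite) bracket \<Rightarrow> bool" where
  "lie_bracket \<mu> \<longleftrightarrow>
    (\<forall>x. Vector_Spaces.linear (*s) (*s) (\<mu> x)) \<and>
    (\<forall>y. Vector_Spaces.linear (*s) (*s) (\<lambda>x. \<mu> x y)) \<and>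
    (\<forall>x. \<mu> x x = 0) \<and>
    (\<forall>x y z. \<mu> x (\<mu> y z) + \<mu> y (\<mu> z x) + \<mu> z (\<mu> x y) = 0)"

(* mu^(k), for k >= 1, as a function of its 2^k arguments x 0, ..., x (2^k - 1).
   The clause for 0 is only a convention that yields mu^(1) = mu. *)
primrec iterated_bracket ::
    "('a::field, 'n::finite) bracket \<Rightarrow> nat \<Rightarrow> (nat \<Rightarrow> 'a ^ 'n) \<Rightarrow> 'a ^ 'n" where
  "iterated_bracket \<mu> 0 x = x 0"
| "iterated_bracket \<mu> (Suc k) x =
    \<mu> (iterated_bracket \<mu> k x) (iterated_bracket \<mu> k (\<lambda>i. x (2 ^ k + i)))"

lemma iterated_bracket_1: "iterated_bracket \<mu> 1 x = \<mu> (x 0) (x 1)"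
  by simp

definition solvable_brackets :: "nat \<Rightarrow> ('a::field, 'n::finite) bracket set" where
  "solvable_brackets k = {\<mu>. lie_bracket \<mu> \<and> (\<forall>x. iterated_bracket \<mu> k x = 0)}"

definition structure_constants ::
    "('a::field, 'n::finite) bracket \<Rightarrow> ('n \<times> 'n \<times> 'n \<Rightarrow> 'a)" where
  "structure_constants \<mu> = (\<lambda>(i, j, l). \<mu> (axis i 1) (axis j 1) $ l)"

definition GL_act ::
    "'a ^ 'n ^ 'n \<Rightarrow> ('a::field, 'n::finite) bracket \<Rightarrow> ('a, 'n) bracket" where
  "GL_act g \<mu> = (\<lambda>x y. g *v \<mu> (matrix_inv g *v x) (matrix_inv g *v y))"

definition GL_orbit :: "('a::field, 'n::finite) bracket \<Rightarrow> ('a, 'n) bracket set" where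
  "GL_orbit \<mu> = {GL_act g \<mu> | g. invertible g}"

(* Intended for mu in solvable_brackets k.  Brackets are viewed as points of affine space
   through structure_constants, which is injective on bilinear maps. *)
definition rigid :: "nat \<Rightarrow> ('a::field, 'n::finite) bracket \<Rightarrow> bool" where
  "rigid k \<mu> \<longleftrightarrow>
    openin (subtopology zariski (structure_constants ` solvable_brackets k))
      (structure_constants ` GL_orbit \<mu>)"

(* For k = 1 only the zero bracket remains, and it is rigid; results on
   non-rigidity therefore need k >= 2. *)
lemma rigid_index_1:
  fixes \<mu> :: "('a::field, 'n::finite) bracket"
  assumes "\<mu> \<in> solvable_brackets 1"
  shows "rigid 1 \<mu>"
proof -
  have zero: "\<nu> = (\<lambda>_ _. 0)" if "\<nu> \<in> solvable_brackets 1" for \<nu> :: "('a, 'n) bracket"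
  proof (intro ext)
    fix u v :: "'a ^ 'n"
    have "iterated_bracket \<nu> 1 (\<lambda>i. if i = 0 then u else v) = 0"
      using that unfolding solvable_brackets_def by blast
    then show "\<nu> u v = 0" by simp
  qed
  have "solvable_brackets 1 = {\<mu>}"
    using assms zero by blast
  moreover have "GL_orbit \<mu> = {\<mu>}"
  proof -
    have "GL_act g \<mu> = \<mu>" for g
      unfolding GL_act_def zero[OF assms] by (simp add: matrix_vector_mult_0_right)
    moreover have "\<exists>g :: 'a ^ 'n ^ 'n. invertible g"
      by (rule exI[of _ "mat 1"]) (auto simp: invertible_def intro!: exI[of _ "mat 1"])
    ultimately show ?thesis
      unfolding GL_orbit_def by auto
  qed
  moreover have "openin zariski (UNIV :: ('n \<times> 'n \<times> 'n \<Rightarrow> 'a) set)"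
    unfolding openin_zariski
    by (rule exI[of _ "{\<lambda>_. 1}"]) (auto simp: zero_locus_def intro: polynomial_functions.const)
  ultimately show ?thesis
    unfolding rigid_def by (auto simp: openin_subtopology intro!: exI[of _ UNIV])
qed

(* 'a ^ ('m + 'n) serves as the direct sum of 'a ^ 'm and 'a ^ 'n. *)
definition direct_sum_bracket ::
    "('a::field, 'm::finite) bracket \<Rightarrow> ('a, 'n::finite) bracket \<Rightarrow> ('a, 'm + 'n) bracket" where
  "direct_sum_bracket \<mu> \<nu> = (\<lambda>x y. \<chi> i. case i of
      Inl a \<Rightarrow> \<mu> (\<chi> b. x $ Inl b) (\<chi> b. y $ Inl b) $ a
    | Inr a \<Rightarrow> \<nu> (\<chi> b. x $ Inr b) (\<chi> b. y $ Inr b) $ a)"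

definition abelian_bracket :: "('a::field, 'n::finite) bracket" where
  "abelian_bracket = (\<lambda>_ _. 0)"

end

theory Submission
  imports Defs
begin

text \<open>Since \<open>\<mu>\<close> is solvable, there is a nonzero linear form \<open>f\<close> vanishing on all brackets. Letting
  the solvable algebra act on the abelian summand through the character \<open>t f\<close> gives a line of
  brackets in \<open>\<S>\<^sub>n\<^sub>,\<^sub>k\<close> (here \<open>k \<ge> 2\<close> is needed) that passes through the direct
  sum at \<open>t = 0\<close>. For \<open>t \<noteq> 0\<close> the derived algebra is larger, because it contains the whole abelian
  summand, so the line meets the orbit of the direct sum only at \<open>t = 0\<close>. A Zariski open subset
  of the line containing \<open>0\<close> is cofinite, so the orbit is not open.\<close>

section \<open>Zariski open sets along an affine line\<close>

lemma polynomial_function_on_line: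
  assumes "p \<in> polynomial_functions"
  shows "\<exists>q. \<forall>t. p (\<lambda>v. c v + t * d v) = poly q t"
  using assms
proof induction
  case (const a)
  show ?case by (rule exI[of _ "[:a:]"]) simp
next
  case (coordinate i)
  show ?case by (rule exI[of _ "[:c i, d i:]"]) simp
next
  case (add p q)
  then obtain r s where "\<forall>t. p (\<lambda>v. c v + t * d v) = poly r t"
    "\<forall>t. q (\<lambda>v. c v + t * d v) = poly s t" by blast
  then show ?case by (intro exI[of _ "r + s"]) simp
next
  case (mult p q)
  then obtain r s where "\<forall>t. p (\<lambda>v. c v + t * d v) = poly r t"
    "\<forall>t. q (\<lambda>v. c v + t * d v) = poly s t" by blast
  then show ?case by (intro exI[of _ "r * s"]) simp
qed

text \<open>Some polynomial defining the complement of \<open>U\<close> does not vanish at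
  \<open>c\<close>. Its restriction to the line is a polynomial in \<open>t\<close> that is nonzero
  at 0, and every \<open>t\<close> at which the line leaves \<open>U\<close> is among its finitely
  many roots.\<close>

lemma open_meets_line_cofinitely:
  fixes c d :: "'v \<Rightarrow> 'a::idom"
  assumes "openin zariski U" and "c \<in> U"
  shows "finite {t. (\<lambda>v. c v + t * d v) \<notin> U}"
proof -
  obtain F where F: "F \<subseteq> polynomial_functions" "- U = zero_locus F"
    using assms(1) unfolding openin_zariski by blast
  have "c \<notin> zero_locus F" using assms(2) F(2) by blast
  then obtain p where p: "p \<in> F" "p c \<noteq> 0" unfolding zero_locus_def by blast
  obtain q where q: "\<And>t. p (\<lambda>v. c v + t * d v) = poly q t"
    using polynomial_function_on_line F(1) p(1) by blast
  have "q \<noteq> 0" using q[of 0] p(2) by auto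
  then have "finite {t. poly q t = 0}" by (rule poly_roots_finite)
  moreover have "{t. (\<lambda>v. c v + t * d v) \<notin> U} \<subseteq> {t. poly q t = 0}"
  proof clarify
    fix t assume "(\<lambda>v. c v + t * d v) \<notin> U"
    then have "(\<lambda>v. c v + t * d v) \<in> zero_locus F" using F(2) by blast
    then show "poly q t = 0" using p(1) q[of t] unfolding zero_locus_def by auto
  qed
  ultimately show ?thesis by (rule rev_finite_subset)
qed

section \<open>Iterated brackets and the derived algebra\<close>

lemma iterated_bracket_cong:
  assumes "\<And>i. i < 2 ^ k \<Longrightarrow> x i = y i"
  shows "iterated_bracket \<mu> k x = iterated_bracket \<mu> k y"
  using assms
proof (induction k arbitrary: x y)
  case (Suc k)
  have "iterated_bracket \<mu> k x = iterated_bracket \<mu> k y"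
    using Suc.prems by (intro Suc.IH) simp
  moreover have "iterated_bracket \<mu> k (\<lambda>i. x (2 ^ k + i)) = iterated_bracket \<mu> k (\<lambda>i. y (2 ^ k + i))"
    using Suc.prems by (intro Suc.IH) simp
  ultimately show ?case by simp
qed simp

lemma bracket_in_range_iterated:
  assumes "u \<in> range (iterated_bracket \<mu> k)" and "v \<in> range (iterated_bracket \<mu> k)"
  shows "\<mu> u v \<in> range (iterated_bracket \<mu> (Suc k))"
proof -
  obtain x y where xy: "u = iterated_bracket \<mu> k x" "v = iterated_bracket \<mu> k y"
    using assms by blast
  \<comment> \<open>Arguments form an infinite sequence of which only the first \<open>2 ^ k\<close>
    entries matter, so the tail of \<open>x\<close> can be overwritten by \<open>y\<close>, shifted
    to where the second copy of the iterated bracket reads.\<close>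
  let ?z = "\<lambda>i. if i < 2 ^ k then x i else y (i - 2 ^ k)"
  have "iterated_bracket \<mu> k ?z = u"
    unfolding xy by (rule iterated_bracket_cong) simp
  then have "\<mu> u v = iterated_bracket \<mu> (Suc k) ?z" by (simp add: xy)
  then show ?thesis by blast
qed

lemma linear_vec_iff:
  "Vector_Spaces.linear (*s) (*s) (h :: 'a::field ^ 'm \<Rightarrow> 'a ^ 'n) \<longleftrightarrow>
    (\<forall>x y. h (x + y) = h x + h y) \<and> (\<forall>c x. h (c *s x) = c *s h x)"
  by (auto simp: Vector_Spaces.linear_iff vec.vector_space_axioms)

lemma lie_bracket_bilinear:
  assumes "lie_bracket \<mu>"
  shows "\<mu> x (y + z) = \<mu> x y + \<mu> x z" "\<mu> x (c *s y) = c *s \<mu> x y"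
    "\<mu> (x + y) z = \<mu> x z + \<mu> y z" "\<mu> (c *s x) y = c *s \<mu> x y" "\<mu> x 0 = 0" "\<mu> 0 x = 0"
proof -
  have 1: "Vector_Spaces.linear (*s) (*s) (\<mu> x)" for x
    using assms unfolding lie_bracket_def by blast
  have 2: "Vector_Spaces.linear (*s) (*s) (\<lambda>x. \<mu> x y)" for y
    using assms unfolding lie_bracket_def by blast
  show "\<mu> x (y + z) = \<mu> x y + \<mu> x z" "\<mu> x (c *s y) = c *s \<mu> x y"
    "\<mu> (x + y) z = \<mu> x z + \<mu> y z" "\<mu> (c *s x) y = c *s \<mu> x y" "\<mu> x 0 = 0" "\<mu> 0 x = 0"
    using vec.linear_add[OF 1] vec.linear_scale[OF 1] vec.linear_0[OF 1]
      vec.linear_add[OF 2] vec.linear_scale[OF 2] vec.linear_0[OF 2] by auto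
qed

abbreviation derived_algebra :: "('a::field, 'n::finite) bracket \<Rightarrow> ('a ^ 'n) set" where
  "derived_algebra \<mu> \<equiv> vec.span {\<mu> x y | x y. True}"

lemma bracket_in_span:
  assumes "lie_bracket \<mu>" and "u \<in> vec.span S" and "v \<in> vec.span T"
  shows "\<mu> u v \<in> vec.span {\<mu> x y | x y. x \<in> S \<and> y \<in> T}" (is "_ \<in> ?R")
proof -
  note bil = lie_bracket_bilinear[OF assms(1)]
  have *: "\<mu> x v \<in> ?R" if "x \<in> S" for x
    using assms(3)
  proof (induction rule: vec.span_induct_alt)
    case base
    show ?case by (simp add: bil vec.span_zero)
  next
    case (step c y z)
    then have "\<mu> x y \<in> ?R" using that by (intro vec.span_base) blast
    with step show ?case by (simp add: bil vec.span_add vec.span_scale)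
  qed
  show ?thesis
    using assms(2)
  proof (induction rule: vec.span_induct_alt)
    case base
    show ?case by (simp add: bil vec.span_zero)
  next
    case (step c x z)
    with *[of x] show ?case by (simp add: bil vec.span_add vec.span_scale)
  qed
qed

text \<open>In a perfect algebra the values of every iterated bracket span the whole space: if those
  at level \<open>j\<close> do, then by bilinearity their brackets span the derived algebra, which
  is everything. Level \<open>k\<close> contradicts solvability.\<close>

lemma solvable_not_perfect:
  fixes \<mu> :: "('a::field, 'n::finite) bracket"
  assumes "\<mu> \<in> solvable_brackets k"
  shows "derived_algebra \<mu> \<noteq> UNIV"
proof
  assume perfect: "derived_algebra \<mu> = UNIV"
  have lie: "lie_bracket \<mu>" using assms unfolding solvable_brackets_def by blast
  have "vec.span (range (iterated_bracket \<mu> j)) = UNIV" for j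
  proof (induction j)
    case 0
    \<comment> \<open>The induction starts at the conventional level 0, which returns its first
      argument and so takes every value.\<close>
    have "x \<in> range (iterated_bracket \<mu> 0)" for x
      by (rule range_eqI[of _ _ "\<lambda>_. x"]) simp
    then have "range (iterated_bracket \<mu> 0) = UNIV" by blast
    then show ?case by simp
  next
    case (Suc j)
    let ?S = "range (iterated_bracket \<mu> j)"
    have "\<mu> u v \<in> vec.span (range (iterated_bracket \<mu> (Suc j)))" for u v
    proof -
      have "\<mu> u v \<in> vec.span {\<mu> x y | x y. x \<in> ?S \<and> y \<in> ?S}"
        by (rule bracket_in_span[OF lie]) (simp_all only: Suc.IH UNIV_I)
      moreover have "{\<mu> x y | x y. x \<in> ?S \<and> y \<in> ?S} \<subseteq> range (iterated_bracket \<mu> (Suc j))"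
        using bracket_in_range_iterated by blast
      ultimately show ?thesis using vec.span_mono by blast
    qed
    then have "derived_algebra \<mu> \<subseteq> vec.span (range (iterated_bracket \<mu> (Suc j)))"
      by (intro vec.span_minimal vec.subspace_span) blast
    then show ?case using perfect by blast
  qed
  moreover have "range (iterated_bracket \<mu> k) = {0}"
    using assms unfolding solvable_brackets_def by auto
  ultimately have "vec.span {0 :: 'a ^ 'n} = UNIV" by metis
  \<comment> \<open>Index types are nonempty, so \<open>undefined\<close> is some index and its unit
    vector is nonzero.\<close>
  then have "axis undefined 1 \<in> vec.span {0 :: 'a ^ 'n}" by blast
  then show False by (simp add: vec.span_singleton axis_eq_0_iff)
qed

section \<open>Characters, that is, one-dimensional representations\<close>

locale character =
  fixes \<mu> :: "('a::field, 'm::finite) bracket" and f :: "'a ^ 'm \<Rightarrow> 'a"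
  assumes lie: "lie_bracket \<mu>"
    and add: "f (x + y) = f x + f y"
    and scale: "f (c *s x) = c * f x"
    and bracket: "f (\<mu> x y) = 0"

lemma character_scale: "character \<mu> f \<Longrightarrow> character \<mu> (\<lambda>x. t * f x)"
  unfolding character_def by (simp add: algebra_simps)

text \<open>A vector \<open>w\<close> outside the derived algebra extends a basis of it to an
  independent set, so a linear map can kill the derived algebra and fix \<open>w\<close>.\<close>

lemma solvable_character_exists:
  fixes \<mu> :: "('a::field, 'm::finite) bracket"
  assumes "\<mu> \<in> solvable_brackets k"
  obtains f w where "character \<mu> f" "f w \<noteq> 0"
proof -
  obtain w where w: "w \<notin> derived_algebra \<mu>" using solvable_not_perfect[OF assms] by blast
  obtain B where B: "B \<subseteq> derived_algebra \<mu>" "vec.independent B" "derived_algebra \<mu> \<subseteq> vec.span B"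
    by (rule vec.basis_exists)
  have span: "vec.span B = derived_algebra \<mu>"
    using B(1,3) by (rule vec.span_subspace) (rule vec.subspace_span)
  have "vec.independent (insert w B)"
    using B(2) w by (simp add: vec.independent_insert span)
  then obtain h where h: "Vector_Spaces.linear (*s) (*s) h"
    "\<And>b. b \<in> insert w B \<Longrightarrow> h b = (if b = w then w else 0)"
    using vec.linear_independent_extend[of "insert w B" "\<lambda>b. if b = w then w else 0"] by blast
  have "w \<noteq> 0" using w vec.span_zero by blast
  \<comment> \<open>The map \<open>h\<close> is vector-valued; a coordinate where \<open>w\<close>
    is nonzero turns it into a linear form.\<close>
  then obtain i where i: "w $ i \<noteq> 0" by (auto simp: vec_eq_iff)
  have "h b = 0" if "b \<in> B" for b
    using h(2)[of b] that w B(1) by auto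
  then have "h x = 0" if "x \<in> derived_algebra \<mu>" for x
    using vec.linear_eq_0_on_span[OF h(1), of B x] that by (simp add: span)
  moreover have "\<mu> x y \<in> derived_algebra \<mu>" for x y
    by (blast intro: vec.span_base)
  ultimately have "h (\<mu> x y) = 0" for x y
    by blast
  then have "character \<mu> (\<lambda>x. h x $ i)"
    using assms vec.linear_add[OF h(1)] vec.linear_scale[OF h(1)]
    unfolding character_def solvable_brackets_def by simp
  moreover have "h w $ i \<noteq> 0" using h(2)[of w] i by simp
  ultimately show ?thesis by (rule that)
qed

section \<open>Deformations of the direct sum by a character\<close>

definition inl_part :: "'a ^ ('m::finite + 'l::finite) \<Rightarrow> 'a ^ 'm" where
  "inl_part x = (\<chi> b. x $ Inl b)"

text \<open>The semidirect product of \<open>\<mu>\<close> with an abelian ideal on which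
  \<open>x\<close> acts as the scalar \<open>f x\<close>.\<close>

definition twisted_sum ::
    "('a::field, 'm::finite) bracket \<Rightarrow> ('a ^ 'm \<Rightarrow> 'a) \<Rightarrow> ('a, 'm + 'l::finite) bracket" where
  "twisted_sum \<mu> f = (\<lambda>x y. \<chi> i. case i of
      Inl a \<Rightarrow> \<mu> (inl_part x) (inl_part y) $ a
    | Inr a \<Rightarrow> f (inl_part x) * y $ Inr a - f (inl_part y) * x $ Inr a)"

lemma inl_part_simps [simp]:
  "inl_part (x + y) = inl_part x + inl_part y"
  "inl_part (c *s x) = c *s inl_part x"
  "inl_part 0 = 0"
  "inl_part (twisted_sum \<mu> f u v) = \<mu> (inl_part u) (inl_part v)"
  by (simp_all add: inl_part_def twisted_sum_def vec_eq_iff)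

lemma twisted_sum_nth [simp]:
  "twisted_sum \<mu> f x y $ Inl a = \<mu> (inl_part x) (inl_part y) $ a"
  "twisted_sum \<mu> f x y $ Inr b = f (inl_part x) * y $ Inr b - f (inl_part y) * x $ Inr b"
  by (simp_all add: twisted_sum_def)

lemma vec_sum_eqI:
  assumes "inl_part x = inl_part y" and "\<And>b. x $ Inr b = y $ Inr b"
  shows "x = y"
  using assms by (auto simp: vec_eq_iff inl_part_def split_sum_all)

lemma direct_sum_abelian: "direct_sum_bracket \<mu> abelian_bracket = twisted_sum \<mu> (\<lambda>_. 0)"
  unfolding direct_sum_bracket_def twisted_sum_def abelian_bracket_def inl_part_def
  by (auto simp: fun_eq_iff vec_eq_iff split: sum.split)

context character
begin

text \<open>In the \<open>Inl\<close> coordinates the Jacobi identity is that of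
  \<open>\<mu>\<close>. In the \<open>Inr\<close> coordinates the terms with \<open>f\<close> of a
  bracket vanish, and the others cancel in pairs because scalars commute.\<close>

lemma lie_bracket_twisted_sum: "lie_bracket (twisted_sum \<mu> f :: ('a, 'm + 'l::finite) bracket)"
proof -
  note bil = lie_bracket_bilinear[OF lie]
  have alt: "\<mu> x x = 0" and jac: "\<mu> x (\<mu> y z) + \<mu> y (\<mu> z x) + \<mu> z (\<mu> x y) = 0" for x y z
    using lie unfolding lie_bracket_def by blast+
  show ?thesis
    unfolding lie_bracket_def linear_vec_iff
    by (intro conjI allI vec_sum_eqI)
      (simp_all add: bil alt jac[unfolded add.assoc] add scale bracket algebra_simps)
qed

lemma solvable_twisted_sum:
  assumes "\<mu> \<in> solvable_brackets k" and "k \<ge> 2"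
  shows "(twisted_sum \<mu> f :: ('a, 'm + 'l::finite) bracket) \<in> solvable_brackets k"
proof -
  let ?\<nu> = "twisted_sum \<mu> f :: ('a, 'm + 'l) bracket"
  have inl: "inl_part (iterated_bracket ?\<nu> j x) = iterated_bracket \<mu> j (\<lambda>i. inl_part (x i))" for j x
    by (induction j arbitrary: x) simp_all
  obtain j where k: "k = Suc (Suc j)"
    using assms(2) by (metis Suc_le_D numeral_2_eq_2 Suc_le_mono)
  have "iterated_bracket ?\<nu> k x = 0" for x
  proof (rule vec_sum_eqI)
    show "inl_part (iterated_bracket ?\<nu> k x) = inl_part 0"
      using assms(1) unfolding inl solvable_brackets_def by simp
    \<comment> \<open>As \<open>k \<ge> 2\<close>, the outermost bracket is taken of two brackets,
      and \<open>f\<close> kills the \<open>Inl\<close> parts of both.\<close>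
    show "iterated_bracket ?\<nu> k x $ Inr b = 0 $ Inr b" for b
      by (simp add: k bracket)
  qed
  then show ?thesis
    using lie_bracket_twisted_sum unfolding solvable_brackets_def by blast
qed

text \<open>The invariant is the dimension of the derived algebra. Membership in the orbit would
  bound that of \<open>?D\<close> by that of the subspace \<open>?DZ\<close>, forcing equality, yet
  only \<open>?D\<close> reaches into the abelian summand.\<close>

lemma twisted_sum_notin_orbit:
  assumes "f w \<noteq> 0"
  shows "(twisted_sum \<mu> f :: ('a, 'm + 'l::finite) bracket) \<notin> GL_orbit (twisted_sum \<mu> (\<lambda>_. 0))"
proof
  let ?\<nu> = "twisted_sum \<mu> f :: ('a, 'm + 'l) bracket"
  let ?Z = "twisted_sum \<mu> (\<lambda>_. 0) :: ('a, 'm + 'l) bracket"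
  let ?D = "derived_algebra ?\<nu>" and ?DZ = "derived_algebra ?Z"
  assume "?\<nu> \<in> GL_orbit ?Z"
  then obtain g where g: "?\<nu> = GL_act g ?Z" unfolding GL_orbit_def by blast
  have "?D \<subseteq> (*v) g ` ?DZ"
  proof (rule vec.span_minimal)
    show "vec.subspace ((*v) g ` ?DZ)"
      by (intro vec.linear_subspace_image matrix_vector_mul_linear_gen vec.subspace_span)
    show "{?\<nu> x y | x y. True} \<subseteq> (*v) g ` ?DZ"
      unfolding g GL_act_def by (blast intro: vec.span_base)
  qed
  then have "vec.dim ?D \<le> vec.dim ?DZ"
    by (meson vec.dim_image_le vec.dim_subset order_trans matrix_vector_mul_linear_gen)
  define embed :: "'a ^ 'm \<Rightarrow> 'a ^ ('m + 'l)" where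
    "embed u = (\<chi> i. case i of Inl a \<Rightarrow> u $ a | Inr _ \<Rightarrow> 0)" for u
  have embed: "inl_part (embed u) = u" "embed u $ Inr b = 0" for u b
    by (simp_all add: embed_def inl_part_def vec_eq_iff)
  have f0: "f 0 = 0" using scale[of 0 0] by simp
  have "?DZ \<subseteq> ?D"
  proof (rule vec.span_mono, clarify)
    fix x y
    \<comment> \<open>\<open>?Z\<close> ignores the abelian parts, and setting them to zero removes
      the terms with \<open>f\<close> from \<open>?\<nu>\<close>.\<close>
    have "?Z x y = ?\<nu> (embed (inl_part x)) (embed (inl_part y))"
      by (rule vec_sum_eqI) (simp_all add: embed)
    then show "\<exists>x' y'. ?Z x y = ?\<nu> x' y' \<and> True" by blast
  qed
  then have "?DZ = ?D"
    using \<open>vec.dim ?D \<le> vec.dim ?DZ\<close> by (intro vec.subspace_dim_equal) (auto simp: vec.subspace_span)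
  define e :: "'a ^ ('m + 'l)" where "e = axis (Inr undefined) 1"
  have e: "inl_part e = 0" "e $ Inr undefined = 1"
    by (simp_all add: e_def inl_part_def axis_def vec_eq_iff)
  \<comment> \<open>The \<open>Inr undefined\<close> coordinate of this bracket is
    \<open>f w\<close>, which is nonzero.\<close>
  have "?\<nu> (embed w) e \<in> ?D" by (blast intro: vec.span_base)
  then have "?\<nu> (embed w) e \<in> ?DZ" using \<open>?DZ = ?D\<close> by simp
  moreover have "x $ Inr undefined = 0" if "x \<in> ?DZ" for x
    using that by (induction rule: vec.span_induct_alt) auto
  ultimately have "?\<nu> (embed w) e $ Inr undefined = 0" by blast
  then show False using assms by (simp add: embed e f0)
qed

end

section \<open>Structure constants and change of basis\<close>

lemma inj_on_structure_constants: "inj_on structure_constants {\<mu>. lie_bracket \<mu>}"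
proof (rule inj_onI, clarify, intro ext)
  fix \<mu> \<nu> :: "('a::field, 'n::finite) bracket" and x y
  assume lie: "lie_bracket \<mu>" "lie_bracket \<nu>" and eq: "structure_constants \<mu> = structure_constants \<nu>"
  have lin: "Vector_Spaces.linear (*s) (*s) (\<mu> x)" "Vector_Spaces.linear (*s) (*s) (\<nu> x)"
    "Vector_Spaces.linear (*s) (*s) (\<lambda>x. \<mu> x y)" "Vector_Spaces.linear (*s) (*s) (\<lambda>x. \<nu> x y)" for x y
    using lie unfolding lie_bracket_def by blast+
  have span: "x \<in> vec.span cart_basis" for x :: "'a ^ 'n"
    by simp
  have basis: "\<mu> a b = \<nu> a b" if "a \<in> cart_basis" "b \<in> cart_basis" for a b
    using that fun_cong[OF eq] unfolding structure_constants_def cart_basis_def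
    by (fastforce simp: vec_eq_iff[of "\<mu> _ _"])
  have "\<mu> a y = \<nu> a y" if "a \<in> cart_basis" for a
    by (rule vec.linear_eq_on[OF lin(1,2) span]) (rule basis[OF that])
  then show "\<mu> x y = \<nu> x y"
    by (rule vec.linear_eq_on[OF lin(3,4) span])
qed

lemma matrix_inv_mult_vec:
  assumes "invertible g"
  shows "matrix_inv g *v (g *v x) = x"
proof -
  \<comment> \<open>\<open>matrix_inv\<close> is defined by choice, so its property comes from the
    existence of an inverse.\<close>
  have "matrix_inv g ** g = mat 1"
    using someI_ex[OF assms[unfolded invertible_def]] unfolding matrix_inv_def by blast
  then show ?thesis by (simp add: matrix_vector_mul_assoc)
qed

text \<open>The inner \<open>g\<close> cancels against its inverse, so the Jacobi sum is the image
  under \<open>g\<close> of that of \<open>\<mu>\<close>. This keeps orbits inside the set where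
  structure constants are injective.\<close>

lemma lie_bracket_GL_act:
  assumes "lie_bracket \<mu>" and "invertible g"
  shows "lie_bracket (GL_act g \<mu>)"
proof -
  note bil = lie_bracket_bilinear[OF assms(1)]
  note inv = matrix_inv_mult_vec[OF assms(2)]
  have alt: "\<mu> x x = 0" and jac: "\<mu> x (\<mu> y z) + \<mu> y (\<mu> z x) + \<mu> z (\<mu> x y) = 0" for x y z
    using assms(1) unfolding lie_bracket_def by blast+
  show ?thesis
    unfolding lie_bracket_def linear_vec_iff GL_act_def
    by (simp add: bil inv alt vec.scale matrix_vector_right_distrib
        jac[THEN arg_cong[where f = "(*v) g"], simplified matrix_vector_right_distrib])
qed

section \<open>Non-rigidity of the direct sum\<close>

theorem theorem6p4:
  fixes \<mu> :: "('a::{alg_closed_field, field_char_0}, 'm::finite) bracket"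
    and k :: nat
  assumes "k \<ge> 2"
    and "\<mu> \<in> solvable_brackets k"
  shows "direct_sum_bracket \<mu> (abelian_bracket :: ('a, 'l::finite) bracket) \<in> solvable_brackets k \<and>
    \<not> rigid k (direct_sum_bracket \<mu> (abelian_bracket :: ('a, 'l) bracket))"
proof -
  obtain f w where f: "character \<mu> f" "f w \<noteq> 0"
    using solvable_character_exists[OF assms(2)] .
  define \<nu> :: "'a \<Rightarrow> ('a, 'm + 'l) bracket" where "\<nu> t = twisted_sum \<mu> (\<lambda>x. t * f x)" for t
  have \<nu>0: "direct_sum_bracket \<mu> abelian_bracket = \<nu> 0"
    by (simp add: \<nu>_def direct_sum_abelian)
  have solvable: "\<nu> t \<in> solvable_brackets k" for t
    unfolding \<nu>_def using character.solvable_twisted_sum[OF character_scale[OF f(1)]] assms by blast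
  have notin: "\<nu> t \<notin> GL_orbit (\<nu> 0)" if "t \<noteq> 0" for t
    using character.twisted_sum_notin_orbit[OF character_scale[OF f(1)], of t w] f(2) that
    by (simp add: \<nu>_def)
  \<comment> \<open>The structure constants are affine in \<open>t\<close>, so the values at 0 and 1
    determine the line.\<close>
  define c d where "c = structure_constants (\<nu> 0)"
    and "d = (\<lambda>v. structure_constants (\<nu> 1) v - c v)"
  have line: "structure_constants (\<nu> t) = (\<lambda>v. c v + t * d v)" for t
  proof (rule ext, clarify)
    fix i j l :: "'m + 'l"
    show "structure_constants (\<nu> t) (i, j, l) = c (i, j, l) + t * d (i, j, l)"
      by (cases l) (simp_all add: c_def d_def \<nu>_def structure_constants_def algebra_simps)
  qed
  have "\<not> rigid k (\<nu> 0)"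
  proof
    assume "rigid k (\<nu> 0)"
    then obtain U where U: "openin zariski U"
      "structure_constants ` GL_orbit (\<nu> 0) = U \<inter> structure_constants ` solvable_brackets k"
      unfolding rigid_def openin_subtopology by blast
    have orbit_lie: "GL_orbit (\<nu> 0) \<subseteq> {\<mu>. lie_bracket \<mu>}"
      using lie_bracket_GL_act solvable[of 0] unfolding GL_orbit_def solvable_brackets_def by blast
    have inv1: "invertible (mat 1 :: 'a ^ ('m + 'l) ^ ('m + 'l))"
      by (auto simp: invertible_def intro!: exI[of _ "mat 1"])
    have "GL_act (mat 1) (\<nu> 0) = \<nu> 0"
      using matrix_inv_mult_vec[OF inv1] by (simp add: GL_act_def)
    with inv1 have "\<nu> 0 \<in> GL_orbit (\<nu> 0)"
      unfolding GL_orbit_def by (metis (mono_tags, lifting) mem_Collect_eq)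
    then have "c \<in> U" using U(2) unfolding c_def by blast
    then have fin: "finite {t. (\<lambda>v. c v + t * d v) \<notin> U}"
      by (rule open_meets_line_cofinitely[OF U(1)])
    have "(\<lambda>v. c v + t * d v) \<notin> U" if "t \<noteq> 0" for t
    proof
      assume "(\<lambda>v. c v + t * d v) \<in> U"
      then have "structure_constants (\<nu> t) \<in> structure_constants ` GL_orbit (\<nu> 0)"
        using U(2) solvable[of t] unfolding line[symmetric] by blast
      moreover have "\<nu> t \<in> {\<mu>. lie_bracket \<mu>}"
        using solvable[of t] unfolding solvable_brackets_def by blast
      \<comment> \<open>Rigidity speaks only of images under \<open>structure_constants\<close>;
        injectivity on Lie brackets brings membership back to the orbit itself.\<close>
      ultimately have "\<nu> t \<in> GL_orbit (\<nu> 0)"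
        using inj_on_image_mem_iff[OF inj_on_structure_constants _ orbit_lie] by blast
      then show False using notin[OF that] by blast
    qed
    \<comment> \<open>All nonzero parameters lie in a finite set, impossible over an infinite
      field.\<close>
    then have "UNIV \<subseteq> insert 0 {t. (\<lambda>v. c v + t * d v) \<notin> U}" by blast
    then have "finite (UNIV :: 'a set)" by (rule finite_subset) (simp add: fin)
    then show False using infinite_UNIV_char_0 by blast
  qed
  then show ?thesis using solvable[of 0] by (simp add: \<nu>0)
qed

end
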